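(* The continuous relaxation of the cut-set formulation of the quadratic minimum spanning tree problem (QMSTP) and the continuous relaxation of its mixed-integer semidefinite formulation do not dominate one another. That is, with the feasible sets $P_{\mathrm{cut}}(G)$ and $P_{\mathrm{sdp}}(G)$ and the maps $\mathcal{B}$, $\mathcal{B}^*$ defined in the context: (1) there exist a connected simple graph $G$ and a pair $(x,Y) \in P_{\mathrm{cut}}(G)$ such that $(\mathcal{B}^*(x),Y) \notin P_{\mathrm{sdp}}(G)$; and (2) there exist a connected simple graph $G$ and a pair $(X,Y) \in P_{\mathrm{sdp}}(G)$ such that $(\mathcal{B}(X),Y) \notin P_{\mathrm{cut}}(G)$.
   Context: Let $G=(V,E)$ be a connected, undirected simple graph with $n=|V|$ vertices and $m=|E|$ edges, with a fixed ordering of $E$. Let $\mathcal{S}^k$ denote the real symmetric $k\times k$ matrices, $\mathbf{1}_k$ the all-ones vector, $\mathbf{J}_k$ the all-ones matrix, $\mathbf{I}_k$ the identity matrix and $\mathbf{0}$ the zero matrix of appropriate size; $\succeq \mathbf{0}$ means positive semidefinite, and $\leq,\geq$ between matrices are entrywise. $\mathrm{diag}(Y)$ is the vector of diagonal entries of $Y$, $\mathrm{Diag}(v)$ is the diagonal matrix with diagonal $v$, and $\langle X,Y\rangle = \mathrm{tr}(XY)$. For $S\subseteq V$, $\delta(S)$ is the set of edges with exactly one endpoint in $S$. Put $\beta = 2(1-\cos(\pi/n))$ and $\alpha=\beta/n$. For a symmetric $X=(x_{ij})\in\mathcal{S}^n$ with $x_{ij}=0$ whenever $\{i,j\}\notin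 E$ (in particular $x_{ii}=0$), $\mathcal{B}(X)\in\mathbb{R}^m$ is the vector of entries $x_{ij}$, $\{i,j\}\in E$, in the fixed edge ordering. Conversely, for $x\in\mathbb{R}^m$, $\mathcal{B}^*(x)\in\mathcal{S}^n$ is the symmetric matrix whose $(i,j)$ and $(j,i)$ entries equal $x_{\{i,j\}}$ if $\{i,j\}\in E$, and all of whose other entries are zero. The feasible set $P_{\mathrm{cut}}(G)$ of the continuous relaxation of the cut-set formulation consists of all pairs $(x,Y)\in[0,1]^m\times\mathcal{S}^m$ with $$\sum_{e\in E}x_e=n-1,\quad \sum_{e\in\delta(S)}x_e\geq 1\ \ \forall\, \emptyset\neq S\subsetneq V,\quad \mathrm{diag}(Y)=x,\quad Y\mathbf{1}_m=(n-1)x,\quad \mathbf{0}\leq Y\leq\mathbf{J}_m .$$ The feasible set $P_{\mathrm{sdp}}(G)$ of the continuous (doubly nonnegative) relaxation of the mixed-integer semidefinite formulation consists of all pairs $(X,Y)$ with $X\in[0,1]^{n\times n}\cap\mathcal{S}^n$, $\langle X,\mathbf{J}_n\rangle=2(n-1)$, $x_{ij}=0$ if $\{i,j\}\notin E$, $Y\in\mathcal{S}^m$, $Y\geq\mathbf{0}$, and $$\mathrm{diag}(Y)=\mathcal{B}(X),\qquad \begin{pmatrix} Y & \mathcal{B}(X)\\ \mathcal{B}(X)^\top & 1\end{pmatrix}\succeq\mathbf{0},\qquad \mathrm{Diag}(X\mathbf{1}_n)-X+\alpha\mathbf{J}_n-\beta\mathbf{I}_n\succeq\mathbf{0}.$$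 Both original formulations minimize $\langle Q,Y\rangle$ for a cost matrix $Q\in\mathcal{S}^m$ and additionally require binarity ($x\in\{0,1\}^m$, respectively $X\in\{0,1\}^{n\times n}$). Domination is compared via the natural maps $(x,Y)\mapsto(\mathcal{B}^*(x),Y)$ and $(X,Y)\mapsto(\mathcal{B}(X),Y)$: one relaxation dominates the other if each of its feasible points is mapped to a feasible point of the other. *)

theory Defs
  imports Complex_Main "Jordan_Normal_Form.Matrix"
begin

(* A graph is given by its number n of vertices (the vertex set is {..<n}, matching the row and
   column indices of n x n matrices) and by the list es of its edges, whose order is the fixed
   ordering of E.  So m = length es, and entry k of a vector in R^m belongs to the edge es ! k. *)

definition simple_graph :: "nat \<Rightarrow> nat set list \<Rightarrow> bool" where
  "simple_graph n es \<longleftrightarrow>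
     distinct es \<and> (\<forall>e \<in> set es. \<exists>i<n. \<exists>j<n. i \<noteq> j \<and> e = {i, j})"

definition connected_graph :: "nat \<Rightarrow> nat set list \<Rightarrow> bool" where
  "connected_graph n es \<longleftrightarrow>
     n \<ge> 1 \<and> (\<forall>u<n. \<forall>v<n. (u, v) \<in> {(a, b). {a, b} \<in> set es}\<^sup>*)"

definition cut_edges :: "nat set list \<Rightarrow> nat set \<Rightarrow> nat set set" where
  "cut_edges es S = {e \<in> set es. card (e \<inter> S) = 1}"

definition sym_mats :: "nat \<Rightarrow> real mat set" where
  "sym_mats k = {A \<in> carrier_mat k k. transpose_mat A = A}"

definition psd :: "real mat \<Rightarrow> bool" where
  "psd A \<longleftrightarrow> A \<in> sym_mats (dim_row A) \<and> (\<forall>v \<in> carrier_vec (dim_row A). 0 \<le> v \<bullet> (A *\<^sub>v v))"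

definition ones_vec :: "nat \<Rightarrow> real vec" where
  "ones_vec k = vec k (\<lambda>_. 1)"

definition ones_mat :: "nat \<Rightarrow> real mat" where
  "ones_mat k = mat k k (\<lambda>_. 1)"

definition diag_vec :: "real mat \<Rightarrow> real vec" where
  "diag_vec A = vec_of_list (diag_mat A)"

definition Diag :: "real vec \<Rightarrow> real mat" where
  "Diag v = mat_diag (dim_vec v) (\<lambda>i. v $ i)"

definition mat_inner :: "real mat \<Rightarrow> real mat \<Rightarrow> real" where
  "mat_inner A B = sum_list (diag_mat (A * B))"

definition beta :: "nat \<Rightarrow> real" where
  "beta n = 2 * (1 - cos (pi / real n))"

definition alpha :: "nat \<Rightarrow> real" where
  "alpha n = beta n / real n"

(* Entry k is X_ij where es ! k = {i, j}; which endpoint is taken as the row index is immaterial,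
   since B is applied to symmetric matrices only. *)
definition B_map :: "nat set list \<Rightarrow> real mat \<Rightarrow> real vec" where
  "B_map es X = vec (length es) (\<lambda>k. X $$ (Min (es ! k), Max (es ! k)))"

definition B_adj :: "nat \<Rightarrow> nat set list \<Rightarrow> real vec \<Rightarrow> real mat" where
  "B_adj n es x = mat n n (\<lambda>(i, j).
     if {i, j} \<in> set es then x $ (THE k. k < length es \<and> es ! k = {i, j}) else 0)"

(* The order on vectors and matrices is the entrywise one. *)

definition P_cut :: "nat \<Rightarrow> nat set list \<Rightarrow> (real vec \<times> real mat) set" where
  "P_cut n es = (let m = length es in
     {(x, Y). x \<in> carrier_vec m \<and> 0\<^sub>v m \<le> x \<and> x \<le> ones_vec m \<and>
        Y \<in> sym_mats m \<and>
        (\<Sum>k<m. x $ k) = real n - 1 \<and>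
        (\<forall>S. S \<noteq> {} \<and> S \<subset> {..<n} \<longrightarrow>
           (\<Sum>k \<in> {k. k < m \<and> es ! k \<in> cut_edges es S}. x $ k) \<ge> 1) \<and>
        diag_vec Y = x \<and>
        Y *\<^sub>v ones_vec m = (real n - 1) \<cdot>\<^sub>v x \<and>
        0\<^sub>m m m \<le> Y \<and> Y \<le> ones_mat m})"

definition P_sdp :: "nat \<Rightarrow> nat set list \<Rightarrow> (real mat \<times> real mat) set" where
  "P_sdp n es = (let m = length es in
     {(X, Y). X \<in> sym_mats n \<and> 0\<^sub>m n n \<le> X \<and> X \<le> ones_mat n \<and>
        mat_inner X (ones_mat n) = 2 * (real n - 1) \<and>
        (\<forall>i<n. \<forall>j<n. {i, j} \<notin> set es \<longrightarrow> X $$ (i, j) = 0) \<and>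
        Y \<in> sym_mats m \<and> 0\<^sub>m m m \<le> Y \<and>
        diag_vec Y = B_map es X \<and>
        psd (four_block_mat Y (mat_of_cols m [B_map es X]) (mat_of_rows m [B_map es X]) (1\<^sub>m 1)) \<and>
        psd (Diag (X *\<^sub>v ones_vec n) - X + alpha n \<cdot>\<^sub>m ones_mat n - beta n \<cdot>\<^sub>m 1\<^sub>m n)})"

end

theory Submission
  imports Defs
begin

text \<open>
  Each relaxation contains a constraint that the other one does not imply, and in both directions a
  point on a small cycle shows this.

  The cut-set relaxation bounds \<open>Y\<close> only linearly: entries in \<open>[0, 1]\<close>, the diagonal, and the row
  sums. On the 4-cycle with \<open>x = 3/4\<close> on every edge, the row sum \<open>9/4\<close> can be realised by giving each
  edge one partner with which its entry of \<open>Y\<close> is \<open>0\<close> while all other entries are \<open>3/4\<close>. The two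
  partner pairs are then too strongly correlated across and too weakly inside: the signed
  indicator of the partition into pairs has quadratic form \<open>-3\<close>, so \<open>Y\<close> is not positive semidefinite
  and no border can make it so (\<open>cycle4_in_P_cut\<close>, \<open>cycle4_not_in_P_sdp\<close>).

  Conversely, positive semidefiniteness of the bordered matrix says \<open>Y - x x\<^sup>T \<succeq> 0\<close>, which does not
  force the row sum equation \<open>Y 1 = (n - 1) x\<close>. On the triangle with \<open>x = 2/3\<close> on every edge, taking
  \<open>Y\<close> to be \<open>x x\<^sup>T\<close> with its diagonal raised to \<open>x\<close> (the second moments of independent edges) gives row
  sums \<open>14/9\<close> instead of \<open>4/3\<close>. The connectivity constraint holds with room to spare, since the
  weighted Laplacian is \<open>2 I - 2/3 J\<close>, with second smallest eigenvalue \<open>2\<close>, whereas \<open>\<beta> = 1\<close>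
  (\<open>triangle_in_P_sdp\<close>, \<open>triangle_not_in_P_cut\<close>).
\<close>

section \<open>Graphs and quadratic forms in coordinates\<close>

lemma connected_graphI:
  assumes "n \<ge> 1" and path: "\<And>i. Suc i < n \<Longrightarrow> {i, Suc i} \<in> set es"
  shows "connected_graph n es"
proof -
  let ?R = "{(a, b). {a, b} \<in> set es}"
  have from0: "v < n \<Longrightarrow> (0, v) \<in> ?R\<^sup>*" for v
  proof (induction v)
    case (Suc v)
    then have "(0, v) \<in> ?R\<^sup>*" by simp
    moreover have "(v, Suc v) \<in> ?R" using path Suc.prems by simp
    ultimately show ?case by (rule rtrancl_into_rtrancl)
  qed simp
  have "sym ?R" by (auto simp: sym_def insert_commute)
  then have "sym (?R\<^sup>*)" by (rule sym_rtrancl)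
  then have "(u, v) \<in> ?R\<^sup>*" if "u < n" "v < n" for u v
    using from0[OF that(1)] from0[OF that(2)] by (meson symE rtrancl_trans)
  then show ?thesis using assms(1) by (simp add: connected_graph_def)
qed

lemma card_edge_Int_eq_1_iff:
  assumes "a \<noteq> b"
  shows "card ({a, b} \<inter> S) = 1 \<longleftrightarrow> (a \<in> S) \<noteq> (b \<in> S)"
  using assms by (auto simp: Int_insert_left)

lemma diag_vec_eq: "diag_vec A = vec (dim_row A) (\<lambda>i. A $$ (i, i))"
  by (rule eq_vecI) (auto simp: diag_vec_def diag_mat_def vec_of_list_index)

lemma mat_inner_eq_sum:
  assumes "A \<in> carrier_mat n n" "B \<in> carrier_mat n n"
  shows "mat_inner A B = (\<Sum>i<n. \<Sum>j<n. A $$ (i, j) * B $$ (j, i))"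
  using assms
  by (simp add: mat_inner_def diag_mat_def scalar_prod_def atLeast0LessThan
        interv_sum_list_conv_sum_set_nat)

lemma quadratic_form_eq_sum:
  fixes A :: "real mat"
  assumes "A \<in> carrier_mat n n" "v \<in> carrier_vec n"
  shows "v \<bullet> (A *\<^sub>v v) = (\<Sum>i<n. \<Sum>j<n. A $$ (i, j) * v $ i * v $ j)"
  using assms
  by (auto simp: scalar_prod_def atLeast0LessThan sum_distrib_left ac_simps intro!: sum.cong)

lemma psdI:
  assumes "A \<in> carrier_mat n n"
    and "\<And>i j. i < n \<Longrightarrow> j < n \<Longrightarrow> A $$ (j, i) = A $$ (i, j)"
    and "\<And>v :: nat \<Rightarrow> real. 0 \<le> (\<Sum>i<n. \<Sum>j<n. A $$ (i, j) * v i * v j)"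
  shows "psd A"
proof -
  have "transpose_mat A = A" using assms(1,2) by (intro eq_matI) auto
  with assms show ?thesis by (auto simp: psd_def sym_mats_def quadratic_form_eq_sum)
qed

text \<open>
  Positive semidefiniteness passes to a principal block because a vector on the block can be padded
  with zeros; the border is then invisible to the quadratic form.
\<close>

lemma psd_border_imp_block_nonneg:
  assumes psd: "psd (four_block_mat Y C R (1\<^sub>m 1))"
    and Y: "Y \<in> carrier_mat m m" and C: "C \<in> carrier_mat m 1" and R: "R \<in> carrier_mat 1 m"
    and v: "v \<in> carrier_vec m"
  shows "0 \<le> v \<bullet> (Y *\<^sub>v v)"
proof -
  let ?A = "four_block_mat Y C R (1\<^sub>m 1)"
  let ?w = "v @\<^sub>v 0\<^sub>v 1"
  have "?w \<in> carrier_vec (dim_row ?A)" using Y v by (auto intro!: carrier_vecI)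
  then have "0 \<le> ?w \<bullet> (?A *\<^sub>v ?w)" using psd unfolding psd_def by blast
  also have "?A *\<^sub>v ?w = (Y *\<^sub>v v + C *\<^sub>v 0\<^sub>v 1) @\<^sub>v (R *\<^sub>v v + 1\<^sub>m 1 *\<^sub>v 0\<^sub>v 1)"
    using Y C R v by (intro four_block_mat_mult_vec) auto
  also have "?w \<bullet> \<dots> = v \<bullet> (Y *\<^sub>v v + C *\<^sub>v 0\<^sub>v 1) + 0\<^sub>v 1 \<bullet> (R *\<^sub>v v + 1\<^sub>m 1 *\<^sub>v 0\<^sub>v 1)"
    using Y C R v by (intro scalar_prod_append[where ?n1.0 = m and ?n2.0 = 1]) auto
  also have "\<dots> = v \<bullet> (Y *\<^sub>v v)" using Y C R v by (simp add: scalar_prod_def)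
  finally show ?thesis .
qed

section \<open>A cut-set point on the 4-cycle that is not positive semidefinite\<close>

definition cycle4 :: "nat set list" where
  "cycle4 = [{0, 1}, {1, 2}, {2, 3}, {0, 3}]"

text \<open>
  Indices are positions in \<open>cycle4\<close>, that is, edges: the partner pairs are the two edges at vertex 1
  and the two edges at vertex 3. The condition is on the unordered pair \<open>{i, j}\<close> so that symmetry
  holds by inspection.
\<close>

definition cycle4_Y :: "real mat" where
  "cycle4_Y = mat 4 4 (\<lambda>(i, j). if {i, j} \<in> {{0, 1}, {2, 3}} then 0 else 3/4)"

lemma length_cycle4: "length cycle4 = 4"
  by (simp add: cycle4_def)

lemma simple_graph_cycle4: "simple_graph 4 cycle4"
  by (simp add: simple_graph_def cycle4_def doubleton_eq_iff numeral_eq_Suc Ex_less_Suc)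

lemma connected_graph_cycle4: "connected_graph 4 cycle4"
  by (rule connected_graphI) (auto simp: cycle4_def less_Suc_eq numeral_eq_Suc)

lemma less_4_iff: "i < 4 \<longleftrightarrow> i \<in> {0, 1, 2, 3 :: nat}"
  by auto

text \<open>
  Walking once around the cycle leaves \<open>S\<close> as often as it enters it, and does so at least once, so
  every cut contains at least two edges and has weight at least \<open>3/2\<close>.
\<close>

lemma cycle4_cut:
  assumes "S \<noteq> {}" "S \<subset> {..<4}"
  shows "1 \<le> (\<Sum>k \<in> {k. k < 4 \<and> cycle4 ! k \<in> cut_edges cycle4 S}. (3/4 :: real))"
proof -
  have "{k. k < 4 \<and> cycle4 ! k \<in> cut_edges cycle4 S} = {k \<in> {..<4}. card (cycle4 ! k \<inter> S) = 1}"
    using nth_mem[of _ cycle4] by (auto simp: cut_edges_def length_cycle4)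
  then have "(\<Sum>k \<in> {k. k < 4 \<and> cycle4 ! k \<in> cut_edges cycle4 S}. (3/4 :: real)) =
      (\<Sum>k<4. if card (cycle4 ! k \<inter> S) = 1 then 3/4 else 0)"
    by (simp only: sum.inter_filter[OF finite_lessThan])
  also have "\<dots> = (\<Sum>(a, b)\<leftarrow>[(0, 1), (1, 2), (2, 3), (0, 3)].
      if (a \<in> S) \<noteq> (b \<in> S) then 3/4 else 0)"
    by (simp add: cycle4_def numeral_eq_Suc lessThan_Suc card_edge_Int_eq_1_iff[simplified])
  also have "\<dots> \<ge> 1"
  proof -
    from assms have "\<exists>i\<in>{0,1,2,3}. i \<in> S" "\<exists>i\<in>{0,1,2,3}. i \<notin> S"
      using less_4_iff by blast+
    then show ?thesis by auto
  qed
  finally show ?thesis .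
qed

lemma cycle4_in_P_cut: "(vec 4 (\<lambda>_. 3/4), cycle4_Y) \<in> P_cut 4 cycle4"
proof -
  note length_cycle4
  moreover have "cycle4_Y \<in> sym_mats 4"
    by (auto simp: sym_mats_def cycle4_Y_def insert_commute)
  moreover have "diag_vec cycle4_Y = vec 4 (\<lambda>_. 3/4)"
    by (auto simp: diag_vec_eq cycle4_Y_def doubleton_eq_iff)
  moreover have "cycle4_Y *\<^sub>v ones_vec 4 = 3 \<cdot>\<^sub>v vec 4 (\<lambda>_. 3/4)"
    by (rule eq_vecI)
      (auto simp: cycle4_Y_def ones_vec_def scalar_prod_def less_4_iff atLeast0LessThan
        lessThan_nat_numeral lessThan_Suc numeral_eq_Suc doubleton_eq_iff)
  moreover have "(\<Sum>k \<in> {k. k < 4 \<and> cycle4 ! k \<in> cut_edges cycle4 S}. vec 4 (\<lambda>_. 3/4) $ k) \<ge> (1::real)"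
    if "S \<noteq> {}" "S \<subset> {..<4}" for S
    using cycle4_cut[OF that] by simp
  ultimately show ?thesis
    by (auto simp: P_cut_def ones_vec_def ones_mat_def less_eq_vec_def less_eq_mat_def
        cycle4_Y_def)
qed

text \<open>
  The first component is arbitrary: \<open>cycle4_Y\<close> by itself already violates the semidefinite constraint.
\<close>

lemma cycle4_not_in_P_sdp: "(B_adj 4 cycle4 x, cycle4_Y) \<notin> P_sdp 4 cycle4"
proof
  assume "(B_adj 4 cycle4 x, cycle4_Y) \<in> P_sdp 4 cycle4"
  then obtain b where
    psd: "psd (four_block_mat cycle4_Y (mat_of_cols 4 [b]) (mat_of_rows 4 [b]) (1\<^sub>m 1))"
    by (auto simp: P_sdp_def Let_def length_cycle4)
  \<comment> \<open>\<open>+1\<close> on one partner pair, \<open>-1\<close> on the other: each row pairs with it to \<open>\<plusminus>(3/4 - 3/2)\<close>.\<close>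
  let ?v = "vec 4 (\<lambda>i. if i < 2 then 1 else - 1 :: real)"
  have "0 \<le> ?v \<bullet> (cycle4_Y *\<^sub>v ?v)"
    by (rule psd_border_imp_block_nonneg[OF psd])
      (auto simp: cycle4_Y_def mat_of_cols_def mat_of_rows_def)
  moreover have "?v \<bullet> (cycle4_Y *\<^sub>v ?v) = - 3"
    by (subst quadratic_form_eq_sum[where n = 4])
      (auto simp: cycle4_Y_def lessThan_Suc numeral_eq_Suc doubleton_eq_iff)
  ultimately show False by simp
qed

section \<open>A semidefinite point on the triangle that violates the row sums\<close>

definition triangle :: "nat set list" where
  "triangle = [{0, 1}, {1, 2}, {0, 2}]"

definition triangle_X :: "real mat" where
  "triangle_X = mat 3 3 (\<lambda>(i, j). if i = j then 0 else 2/3)"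

definition triangle_Y :: "real mat" where
  "triangle_Y = mat 3 3 (\<lambda>(i, j). if i = j then 2/3 else 4/9)"

lemma length_triangle: "length triangle = 3"
  by (simp add: triangle_def)

lemma simple_graph_triangle: "simple_graph 3 triangle"
  by (simp add: simple_graph_def triangle_def doubleton_eq_iff numeral_eq_Suc Ex_less_Suc)

lemma connected_graph_triangle: "connected_graph 3 triangle"
  by (rule connected_graphI) (auto simp: triangle_def less_Suc_eq numeral_eq_Suc)

lemma B_map_triangle: "B_map triangle triangle_X = vec 3 (\<lambda>_. 2/3)"
  by (rule eq_vecI)
    (auto simp: B_map_def triangle_def triangle_X_def less_Suc_eq numeral_eq_Suc)

lemma triangle_in_P_sdp: "(triangle_X, triangle_Y) \<in> P_sdp 3 triangle"
proof -
  let ?b = "vec 3 (\<lambda>_. 2/3 :: real)"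
  have psd_Y: "psd (four_block_mat triangle_Y (mat_of_cols 3 [?b]) (mat_of_rows 3 [?b]) (1\<^sub>m 1))"
    (is "psd ?A")
  proof (rule psdI[where n = 4])
    fix v :: "nat \<Rightarrow> real"
    \<comment> \<open>Completing the square in the border variable \<open>v 3\<close> leaves the Schur complement
      \<open>Y - x x\<^sup>T = 2/9 I\<close>.\<close>
    have "(\<Sum>i<4. \<Sum>j<4. ?A $$ (i, j) * v i * v j) =
        (v 3 + 2/3 * (v 0 + v 1 + v 2))\<^sup>2 + 2/9 * ((v 0)\<^sup>2 + (v 1)\<^sup>2 + (v 2)\<^sup>2)"
      by (simp add: triangle_Y_def mat_of_cols_def mat_of_rows_def lessThan_Suc numeral_eq_Suc
            power2_eq_square) (simp add: field_simps)
    also have "\<dots> \<ge> 0" by simp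
    finally show "0 \<le> (\<Sum>i<4. \<Sum>j<4. ?A $$ (i, j) * v i * v j)" .
  qed (auto simp: triangle_Y_def mat_of_cols_def mat_of_rows_def)
  have beta3: "beta 3 = 1" by (simp add: beta_def cos_60)
  then have alpha3: "alpha 3 = 1/3" by (simp add: alpha_def)
  have psd_L: "psd (Diag (triangle_X *\<^sub>v ones_vec 3) - triangle_X + alpha 3 \<cdot>\<^sub>m ones_mat 3 - beta 3 \<cdot>\<^sub>m 1\<^sub>m 3)"
    (is "psd ?L")
  proof -
    have L: "?L = mat 3 3 (\<lambda>(i, j). if i = j then 2/3 else - 1/3)"
      unfolding beta3 alpha3
      by (rule eq_matI)
        (auto simp: triangle_X_def Diag_def mat_diag_def ones_vec_def ones_mat_def
          scalar_prod_def atLeast0LessThan lessThan_Suc numeral_eq_Suc less_Suc_eq)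
    \<comment> \<open>\<open>I - 1/3 J\<close> is \<open>1/3\<close> times the Laplacian of the unweighted triangle, so its form is a third
      of the sum of the squared differences along the edges.\<close>
    have "(\<Sum>i<3. \<Sum>j<3. ?L $$ (i, j) * v i * v j) =
        1/3 * ((v 0 - v 1)\<^sup>2 + (v 1 - v 2)\<^sup>2 + (v 0 - v 2)\<^sup>2)" for v :: "nat \<Rightarrow> real"
      unfolding L by (simp add: lessThan_Suc numeral_eq_Suc power2_eq_square algebra_simps)
    then have "0 \<le> (\<Sum>i<3. \<Sum>j<3. ?L $$ (i, j) * v i * v j)" for v :: "nat \<Rightarrow> real"
      by (simp only:) simp
    then show ?thesis by (rule psdI[rotated 2]) (simp_all add: L)
  qed
  have "mat_inner triangle_X (ones_mat 3) = 4"
    by (subst mat_inner_eq_sum[where n = 3])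
      (auto simp: triangle_X_def ones_mat_def lessThan_Suc numeral_eq_Suc)
  moreover have "triangle_X $$ (i, j) = 0" if "i < 3" "j < 3" "{i, j} \<notin> set triangle" for i j
    using that by (auto simp: triangle_X_def triangle_def less_Suc_eq numeral_eq_Suc insert_commute)
  moreover have "diag_vec triangle_Y = ?b"
    by (auto simp: diag_vec_eq triangle_Y_def)
  moreover note length_triangle
  moreover have "triangle_X \<in> sym_mats 3" "triangle_Y \<in> sym_mats 3"
    by (auto simp: sym_mats_def triangle_X_def triangle_Y_def)
  moreover have "0\<^sub>m 3 3 \<le> triangle_X" "triangle_X \<le> ones_mat 3" "0\<^sub>m 3 3 \<le> triangle_Y"
    by (auto simp: less_eq_mat_def triangle_X_def triangle_Y_def ones_mat_def)
  ultimately show ?thesis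
    using psd_Y psd_L by (simp add: P_sdp_def B_map_triangle)
qed

lemma triangle_not_in_P_cut: "(x, triangle_Y) \<notin> P_cut 3 triangle"
proof
  assume "(x, triangle_Y) \<in> P_cut 3 triangle"
  then have "triangle_Y *\<^sub>v ones_vec 3 = 2 \<cdot>\<^sub>v diag_vec triangle_Y"
    by (auto simp: P_cut_def Let_def length_triangle)
  then have "(triangle_Y *\<^sub>v ones_vec 3) $ 0 = (2 \<cdot>\<^sub>v diag_vec triangle_Y) $ 0" by simp
  moreover have "(triangle_Y *\<^sub>v ones_vec 3) $ 0 = 14/9"
    by (simp add: triangle_Y_def ones_vec_def scalar_prod_def atLeast0LessThan
        lessThan_Suc numeral_eq_Suc)
  moreover have "(2 \<cdot>\<^sub>v diag_vec triangle_Y) $ 0 = 4/3"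
    by (simp add: diag_vec_eq triangle_Y_def)
  ultimately show False by simp
qed

theorem corollary1:
  shows "(\<exists>n es. simple_graph n es \<and> connected_graph n es \<and>
            (\<exists>x Y. (x, Y) \<in> P_cut n es \<and> (B_adj n es x, Y) \<notin> P_sdp n es))
       \<and> (\<exists>n es. simple_graph n es \<and> connected_graph n es \<and>
            (\<exists>X Y. (X, Y) \<in> P_sdp n es \<and> (B_map es X, Y) \<notin> P_cut n es))"
  using simple_graph_cycle4 connected_graph_cycle4 cycle4_in_P_cut cycle4_not_in_P_sdp
    simple_graph_triangle connected_graph_triangle triangle_in_P_sdp triangle_not_in_P_cut
  by blast

end
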